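(* Let $m^{3/4} < k < m/\log^2 m$. Any algorithm that, for non-negative linear systems $(A,b)$, finds an $o(k/\epsilon^2)$-sparse $\epsilon$-approximate solution can solve the planted set cover $(k,m)$ problem.
   Context: A vector is $s$-sparse if it has at most $s$ nonzero entries; an $\epsilon$-approximate solution to $Ax=b$ (with $A,b$ non-negative) is a non-negative $x$ with $\|Ax-b\|_1\le\epsilon\|b\|_1$. The planted set cover $(k,m)$ problem (for $k>m^{3/4}$): distinguish, with success probability greater than $2/3$, between the following two distributions over set systems on $m$ elements with $n=O(m/\log m)$ sets. No case: the set system is random, with each element $i$ in each set $j$ independently with probability $1/k$. Yes case: take a random set system with $n-k$ sets as in the No case and add a uniformly random partition of the $m$ elements into $k$ parts as the remaining $k$ sets (so there is a perfect cover using $k$ sets). *)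

theory Defs
  imports
    "HOL-Probability.Probability"
    "HOL-Combinatorics.Combinatorics"
    "HOL-Library.Landau_Symbols"
    "Jordan_Normal_Form.Matrix"
begin

definition l1_norm :: "real vec \<Rightarrow> real" where
  "l1_norm v = (\<Sum>i<dim_vec v. \<bar>v $ i\<bar>)"

definition nonneg_vec :: "real vec \<Rightarrow> bool" where
  "nonneg_vec v \<longleftrightarrow> (\<forall>i<dim_vec v. 0 \<le> v $ i)"

definition nonneg_mat :: "real mat \<Rightarrow> bool" where
  "nonneg_mat A \<longleftrightarrow> (\<forall>i<dim_row A. \<forall>j<dim_col A. 0 \<le> A $$ (i, j))"

text \<open>The bound \<open>s\<close> is a real number because asymptotic bounds such as
  \<open>c * k / \<epsilon>\<^sup>2\<close> are not integers in general.\<close>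

definition sparse :: "real \<Rightarrow> real vec \<Rightarrow> bool" where
  "sparse s v \<longleftrightarrow> real (card {i. i < dim_vec v \<and> v $ i \<noteq> 0}) \<le> s"

definition nonneg_system :: "real mat \<Rightarrow> real vec \<Rightarrow> bool" where
  "nonneg_system A b \<longleftrightarrow> dim_vec b = dim_row A \<and> nonneg_mat A \<and> nonneg_vec b"

definition exact_solution :: "real mat \<Rightarrow> real vec \<Rightarrow> real vec \<Rightarrow> bool" where
  "exact_solution A b x \<longleftrightarrow> dim_vec x = dim_col A \<and> nonneg_vec x \<and> A *\<^sub>v x = b"

definition approx_solution :: "real \<Rightarrow> real mat \<Rightarrow> real vec \<Rightarrow> real vec \<Rightarrow> bool" where
  "approx_solution \<epsilon> A b x \<longleftrightarrow>
     dim_vec x = dim_col A \<and> nonneg_vec x \<and> l1_norm (A *\<^sub>v x - b) \<le> \<epsilon> * l1_norm b"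

text \<open>An algorithm receives \<open>k\<close>, \<open>\<epsilon>\<close>, \<open>A\<close>, \<open>b\<close>; it is only
  required to succeed if the system has a \<open>k\<close>-sparse non-negative exact solution. Without
  this promise even the system with the identity matrix has no sparse approximate
  solution. Nothing is assumed about the output on other inputs.\<close>

type_synonym solver = "nat \<Rightarrow> real \<Rightarrow> real mat \<Rightarrow> real vec \<Rightarrow> real vec"

definition finds_sparse_solutions :: "solver \<Rightarrow> (nat \<Rightarrow> real \<Rightarrow> real) \<Rightarrow> bool" where
  "finds_sparse_solutions alg s \<longleftrightarrow>
     (\<forall>k \<epsilon> A b. 0 < \<epsilon> \<and> \<epsilon> < 1 \<and> nonneg_system A b \<and>
        (\<exists>x. exact_solution A b x \<and> sparse (real k) x) \<longrightarrow>
        approx_solution \<epsilon> A b (alg k \<epsilon> A b) \<and> sparse (s k \<epsilon>) (alg k \<epsilon> A b))"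

text \<open>A set system on the elements \<open>{..<m}\<close> is the list of its sets.\<close>

definition random_set :: "nat \<Rightarrow> nat \<Rightarrow> nat set pmf" where
  "random_set m k =
     map_pmf (\<lambda>f. {i. i < m \<and> f i}) (Pi_pmf {..<m} False (\<lambda>_. bernoulli_pmf (1 / real k)))"

definition no_case :: "nat \<Rightarrow> nat \<Rightarrow> nat \<Rightarrow> nat set list pmf" where
  "no_case m k n = replicate_pmf n (random_set m k)"

text \<open>The sets of a planted system are listed in uniformly random order, so that the
  positions in the list do not reveal which sets form the partition. (The list drawn in
  \<open>no_case\<close> is exchangeable already.)\<close>

definition yes_case :: "nat \<Rightarrow> nat \<Rightarrow> nat \<Rightarrow> nat set list pmf" where
  "yes_case m k n = do {
     F \<leftarrow> replicate_pmf (n - k) (random_set m k);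
     P \<leftarrow> pmf_of_set {P. partition_on {..<m} P \<and> card P = k};
     pmf_of_set (permutations_of_multiset (mset F + mset_set P))
   }"

text \<open>Here \<open>k\<close> and \<open>n\<close> are functions of \<open>m\<close>, and \<open>D m F\<close> is the answer ``yes'' on the
  set system \<open>F\<close>. As \<open>n\<close> is only constrained up to constants, success is required for all
  sufficiently large \<open>m\<close>.\<close>

definition solves_planted_set_cover ::
    "(nat \<Rightarrow> nat) \<Rightarrow> (nat \<Rightarrow> nat) \<Rightarrow> (nat \<Rightarrow> nat set list \<Rightarrow> bool) \<Rightarrow> bool" where
  "solves_planted_set_cover k n D \<longleftrightarrow>
     (\<forall>\<^sub>F m in at_top.
        measure_pmf.prob (yes_case m (k m) (n m)) {F. D m F} > 2 / 3 \<and>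
        measure_pmf.prob (no_case m (k m) (n m)) {F. \<not> D m F} > 2 / 3)"

definition incidence_mat :: "nat \<Rightarrow> nat set list \<Rightarrow> real mat" where
  "incidence_mat m F = mat m (length F) (\<lambda>(i, j). if i \<in> F ! j then 1 else 0)"

definition ones_vec :: "nat \<Rightarrow> real vec" where
  "ones_vec m = vec m (\<lambda>_. 1)"

text \<open>The decision procedure derived from \<open>alg\<close>: run it once on the covering system
  \<open>A x = 1\<close> of the given set system and answer ``yes'' iff the returned vector passes the
  (easily checked) test of being a \<open>t\<close>-sparse \<open>\<epsilon>\<close>-approximate solution. The check is needed
  since the output of \<open>alg\<close> is arbitrary when the promise fails.\<close>

definition decide_by :: "solver \<Rightarrow> real \<Rightarrow> real \<Rightarrow> nat \<Rightarrow> nat \<Rightarrow> nat set list \<Rightarrow> bool" where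
  "decide_by alg \<epsilon> t k m F \<longleftrightarrow>
     (let A = incidence_mat m F; b = ones_vec m; x = alg k \<epsilon> A b
      in approx_solution \<epsilon> A b x \<and> sparse t x)"

text \<open>An unrestricted existential over decision procedures would not involve \<open>alg\<close> at all,
  so the procedure must have the form above; the accuracy \<open>\<epsilon>\<close> and the constant \<open>c\<close> in the
  threshold do not depend on \<open>m\<close>.\<close>

definition can_solve_planted_set_cover :: "solver \<Rightarrow> (nat \<Rightarrow> nat) \<Rightarrow> (nat \<Rightarrow> nat) \<Rightarrow> bool" where
  "can_solve_planted_set_cover alg k n \<longleftrightarrow>
     (\<exists>\<epsilon> c. 0 < \<epsilon> \<and> \<epsilon> < 1 \<and> 0 < c \<and>
        solves_planted_set_cover k n
          (\<lambda>m. decide_by alg \<epsilon> (c * real (k m) / \<epsilon>\<^sup>2) (k m) m))"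

end

theory Submission
  imports Defs "HOL-Real_Asymp.Real_Asymp"
begin

text \<open>
  In the yes case the indicator vector of the planted partition is a \<open>k\<close>-sparse exact solution of
  the covering system, so the returned vector always passes the test. In the no case no sparse
  \<open>\<epsilon>\<close>-approximate solution exists with high probability. For a fixed \<open>x\<close> with at most
  \<open>c k / \<epsilon>\<^sup>2\<close> nonzero entries, a row of \<open>A x\<close> is a sum \<open>Y\<close> of independent
  contributions \<open>x\<^sub>j\<close>, each present with probability \<open>1 / k\<close>; if its mean is of order 1,
  its characteristic function is bounded away from 1 at some frequency of order at most \<open>1 / \<epsilon>\<close>,
  which forces the truncated deviation \<open>min 1 \<bar>Y - 1\<bar>\<close> to have mean at least \<open>8 \<epsilon>\<close>.
  The rows are independent, so the total deviation is at most \<open>2 \<epsilon> m\<close> with probability at most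
  \<open>exp (- 2 \<epsilon> m)\<close>. After truncating the entries of \<open>x\<close> at 2 and rounding them to multiples of
  \<open>1 / m\<^sup>2\<close>, only \<open>exp (O(k / \<epsilon>\<^sup>2 * ln m)) = exp (o(m))\<close> vectors remain for the union bound.
\<close>

section \<open>Expected deviation of a single random row from 1\<close>

text \<open>Up to 2 the cubic Taylor term of the sine dominates the quintic one; beyond 2 the bound
  \<open>sin u \<le> 1\<close> is enough. Since \<open>u - sin u\<close> is the integral of
  \<open>1 - cos\<close>, this controls averages of \<open>1 - cos\<close> over frequencies.\<close>

lemma sin_le_diff_min:
  fixes u :: real
  assumes "0 \<le> u"
  shows "u * min 1 (u\<^sup>2) / 10 \<le> u - sin u"
proof (cases "u \<le> 2")
  case True
  have "\<bar>sin u - (\<Sum>m<5. sin_coeff m * u ^ m)\<bar> \<le> inverse (fact 5) * \<bar>u\<bar> ^ 5"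
    by (rule Maclaurin_sin_bound)
  moreover have "(\<Sum>m<5. sin_coeff m * u ^ m) = u - u ^ 3 / 6"
    by (simp add: eval_nat_numeral sin_coeff_Suc cos_coeff_Suc)
  moreover have "inverse (fact 5 :: real) * \<bar>u\<bar> ^ 5 = u ^ 5 / 120"
    using assms by (simp add: fact_numeral)
  ultimately have "sin u \<le> u - u ^ 3 / 6 + u ^ 5 / 120"
    by linarith
  moreover have "u ^ 5 / 120 \<le> u ^ 3 / 30"
  proof -
    have "u ^ 2 \<le> 4"
      using True assms power_mono[of u 2 2] by simp
    then have "u ^ 3 * u ^ 2 \<le> u ^ 3 * 4"
      using assms by (intro mult_left_mono) auto
    moreover have "u ^ 3 * u ^ 2 = u ^ 5"
      by (simp flip: power_add)
    ultimately show ?thesis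
      by simp
  qed
  moreover have "u * min 1 (u\<^sup>2) \<le> u ^ 3"
    using assms mult_left_mono[of "min 1 (u\<^sup>2)" "u\<^sup>2" u] by (simp add: power3_eq_cube power2_eq_square mult.assoc)
  moreover have "0 \<le> u ^ 3"
    using assms by simp
  ultimately show ?thesis
    by linarith
next
  case False
  have "u * min 1 (u\<^sup>2) \<le> u * 1"
    using assms by (intro mult_left_mono) auto
  then show ?thesis
    using False sin_le_one[of u] by linarith
qed

lemma finite_set_replicate_pmf:
  "finite (set_pmf p) \<Longrightarrow> finite (set_pmf (replicate_pmf n p))"
  using finite_lists_length_eq[of "set_pmf p" n]
  by (simp add: set_replicate_pmf lists_eq_set conj_commute)

lemma expectation_replicate_pmf_Suc:
  fixes f :: "'a list \<Rightarrow> 'b :: {banach, second_countable_topology}"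
  assumes "finite (set_pmf p)"
  shows "measure_pmf.expectation (replicate_pmf (Suc n) p) f =
    measure_pmf.expectation p (\<lambda>x. measure_pmf.expectation (replicate_pmf n p) (\<lambda>xs. f (x # xs)))"
proof -
  note fin = finite_set_replicate_pmf[OF assms, of n]
  have "replicate_pmf (Suc n) p = p \<bind> (\<lambda>x. map_pmf ((#) x) (replicate_pmf n p))"
    by (simp add: map_pmf_def)
  then have "measure_pmf.expectation (replicate_pmf (Suc n) p) f =
      (\<Sum>x\<in>set_pmf p. pmf p x *\<^sub>R measure_pmf.expectation (replicate_pmf n p) (\<lambda>xs. f (x # xs)))"
    using assms fin by (simp add: pmf_expectation_bind[of "set_pmf p"])
  also have "\<dots> = measure_pmf.expectation p
      (\<lambda>x. measure_pmf.expectation (replicate_pmf n p) (\<lambda>xs. f (x # xs)))"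
    using assms by (subst integral_measure_pmf[of "set_pmf p"]) auto
  finally show ?thesis .
qed

text \<open>The bit list stands for one row of the random 0/1 matrix. The list form follows the
  recursion of \<open>replicate_pmf\<close>, so that expectations can be computed one column at a
  time.\<close>

fun weight :: "real list \<Rightarrow> bool list \<Rightarrow> real" where
  "weight (x # xs) (b # bs) = (if b then x else 0) + weight xs bs"
| "weight _ _ = 0"

abbreviation bits :: "nat \<Rightarrow> real \<Rightarrow> bool list pmf" where
  "bits n p \<equiv> replicate_pmf n (bernoulli_pmf p)"

lemma finite_set_bits [simp]: "finite (set_pmf (bits n p))"
  by (rule finite_set_replicate_pmf) (rule finite)

lemma integrable_bits [simp]:
  fixes f :: "bool list \<Rightarrow> 'b :: {banach, second_countable_topology}"
  shows "integrable (measure_pmf (bits n p)) f"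
  by (rule integrable_measure_pmf_finite) simp

lemma expectation_bits_Suc:
  fixes f :: "bool list \<Rightarrow> 'b :: {banach, second_countable_topology}"
  assumes "0 \<le> p" "p \<le> 1"
  shows "measure_pmf.expectation (bits (Suc n) p) f =
    p *\<^sub>R measure_pmf.expectation (bits n p) (\<lambda>bs. f (True # bs)) +
    (1 - p) *\<^sub>R measure_pmf.expectation (bits n p) (\<lambda>bs. f (False # bs))"
  using assms
  by (subst expectation_replicate_pmf_Suc, simp)
    (subst integral_measure_pmf[of UNIV], auto simp: UNIV_bool)

lemma expectation_weight:
  assumes "0 \<le> p" "p \<le> 1"
  shows "measure_pmf.expectation (bits (length xs) p) (weight xs) = p * sum_list xs"
proof (induction xs)
  case (Cons x xs)
  then show ?case
    unfolding list.size add_0_right add_Suc_right expectation_bits_Suc[OF assms]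
    by (simp add: algebra_simps)
qed simp

text \<open>The squared norm is exactly \<open>1 - 2 * p * (1 - p) * (1 - cos a)\<close>, and
  \<open>1 + y \<le> exp y\<close> brings it into a form that multiplies well over independent
  terms.\<close>

lemma norm_bernoulli_cis_le:
  assumes "0 \<le> p" "p \<le> 1"
  shows "norm (complex_of_real p * cis a + complex_of_real (1 - p)) \<le> exp (- (p * (1 - p) * (1 - cos a)))"
proof (rule power2_le_imp_le)
  have expand: "(p * c + (1 - p))\<^sup>2 + (p * s)\<^sup>2 = p\<^sup>2 * (c\<^sup>2 + s\<^sup>2) + 2 * p * (1 - p) * c + (1 - p)\<^sup>2"
    for c s :: real
    by (simp add: power2_eq_square algebra_simps)
  have "(norm (complex_of_real p * cis a + complex_of_real (1 - p)))\<^sup>2 =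
      (p * cos a + (1 - p))\<^sup>2 + (p * sin a)\<^sup>2"
    by (simp add: cmod_power2)
  also have "\<dots> = p\<^sup>2 * ((cos a)\<^sup>2 + (sin a)\<^sup>2) + 2 * p * (1 - p) * cos a + (1 - p)\<^sup>2"
    by (rule expand)
  also have "\<dots> = 1 + (- 2 * (p * (1 - p) * (1 - cos a)))"
    unfolding sin_cos_squared_add2 by (simp add: power2_eq_square algebra_simps)
  also have "\<dots> \<le> exp (- 2 * (p * (1 - p) * (1 - cos a)))"
    by (rule exp_ge_add_one_self)
  also have "\<dots> = (exp (- (p * (1 - p) * (1 - cos a))))\<^sup>2"
    by (simp add: exp_double [symmetric])
  finally show "(norm (complex_of_real p * cis a + complex_of_real (1 - p)))\<^sup>2 \<le> \<dots>" .
qed simp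

text \<open>By independence the characteristic function is a product over the entries, and the
  exponents of the bounds on the factors add up.\<close>

lemma norm_expectation_cis_weight_le:
  assumes "0 \<le> p" "p \<le> 1"
  shows "norm (measure_pmf.expectation (bits (length xs) p) (\<lambda>bs. cis (\<omega> * weight xs bs)))
    \<le> exp (- (p * (1 - p) * (\<Sum>x\<leftarrow>xs. 1 - cos (\<omega> * x))))"
proof (induction xs)
  case (Cons x xs)
  have "measure_pmf.expectation (bits (length (x # xs)) p) (\<lambda>bs. cis (\<omega> * weight (x # xs) bs)) =
      (complex_of_real p * cis (\<omega> * x) + complex_of_real (1 - p)) *
      measure_pmf.expectation (bits (length xs) p) (\<lambda>bs. cis (\<omega> * weight xs bs))"
    unfolding list.size add_0_right add_Suc_right expectation_bits_Suc[OF assms]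
    by (simp add: distrib_left flip: cis_mult) (simp add: scaleR_conv_of_real algebra_simps)
  also have "norm \<dots> \<le> exp (- (p * (1 - p) * (1 - cos (\<omega> * x)))) *
      exp (- (p * (1 - p) * (\<Sum>x\<leftarrow>xs. 1 - cos (\<omega> * x))))"
    unfolding norm_mult
    by (intro mult_mono norm_bernoulli_cis_le assms Cons.IH) auto
  finally show ?case
    by (simp add: algebra_simps flip: exp_add)
qed simp

lemma weight_nonneg: "(\<forall>x\<in>set xs. 0 \<le> x) \<Longrightarrow> 0 \<le> weight xs bs"
  by (induction xs bs rule: weight.induct) auto

lemma exists_frequency:
  assumes "finite S" "0 < \<omega>\<^sub>0" "\<And>j. j \<in> S \<Longrightarrow> 0 < (x j :: real)"
  obtains \<omega> where "0 < \<omega>" "\<omega> < \<omega>\<^sub>0"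
    "(\<Sum>j\<in>S. min 1 ((\<omega>\<^sub>0 * x j)\<^sup>2)) / 10 \<le> (\<Sum>j\<in>S. 1 - cos (\<omega> * x j))"
proof -
  have ne: "x j \<noteq> 0" if "j \<in> S" for j
    using assms(3)[OF that] by simp
  \<comment> \<open>The antiderivative of the right-hand side, so that the mean value theorem averages it over the
    frequencies up to \<open>\<omega>\<^sub>0\<close>; no single frequency works for every \<open>x\<close>.\<close>
  define F where "F \<omega> = (\<Sum>j\<in>S. \<omega> - sin (\<omega> * x j) / x j)" for \<omega>
  have "(F has_real_derivative (\<Sum>j\<in>S. 1 - cos (\<omega> * x j))) (at \<omega>)" for \<omega>
    unfolding F_def by (auto intro!: derivative_eq_intros sum.cong simp: ne)
  then obtain \<omega> where \<omega>: "0 < \<omega>" "\<omega> < \<omega>\<^sub>0"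
      and F: "F \<omega>\<^sub>0 - F 0 = (\<omega>\<^sub>0 - 0) * (\<Sum>j\<in>S. 1 - cos (\<omega> * x j))"
    using MVT2[of 0 \<omega>\<^sub>0 F "\<lambda>\<omega>. \<Sum>j\<in>S. 1 - cos (\<omega> * x j)"] assms(2) by blast
  have "\<omega>\<^sub>0 * ((\<Sum>j\<in>S. min 1 ((\<omega>\<^sub>0 * x j)\<^sup>2)) / 10) =
      (\<Sum>j\<in>S. (\<omega>\<^sub>0 * x j * min 1 ((\<omega>\<^sub>0 * x j)\<^sup>2) / 10) / x j)"
    by (auto simp: sum_distrib_left sum_divide_distrib ne intro!: sum.cong)
  also have "\<dots> \<le> (\<Sum>j\<in>S. (\<omega>\<^sub>0 * x j - sin (\<omega>\<^sub>0 * x j)) / x j)"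
    using assms by (intro sum_mono divide_right_mono sin_le_diff_min) (auto simp: less_imp_le)
  also have "\<dots> = F \<omega>\<^sub>0"
    unfolding F_def by (auto simp: diff_divide_distrib ne intro!: sum.cong)
  also have "\<dots> = \<omega>\<^sub>0 * (\<Sum>j\<in>S. 1 - cos (\<omega> * x j))"
    using F by (simp add: F_def)
  finally show thesis
    using that \<omega> assms(2) by (simp add: mult_le_cancel_left)
qed

text \<open>The cap at 1 keeps the deviation in a range where
  \<open>exp (- g) \<le> 1 - g / 2\<close>, and it makes entries of a solution above 2
  indistinguishable from 2.\<close>

definition dev :: "real \<Rightarrow> real" where
  "dev y = min 1 \<bar>y - 1\<bar>"

lemma dev_nonneg: "0 \<le> dev y" and dev_le_1: "dev y \<le> 1"
  by (auto simp: dev_def)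

text \<open>The linear part of \<open>dev\<close> comes from
  \<open>1 - cos u \<le> \<bar>u\<bar>\<close>, its cap from
  \<open>1 - cos u \<le> 2\<close>.\<close>

lemma one_minus_cos_le_dev:
  assumes "0 < \<omega>" "\<omega> \<le> \<omega>\<^sub>0" "2 \<le> \<omega>\<^sub>0"
  shows "1 - cos (\<omega> * (y - 1)) \<le> \<omega>\<^sub>0 * dev y"
proof -
  have "1 - cos u \<le> \<bar>u\<bar>" for u :: real
  proof -
    have "1 - cos u = 2 * (\<bar>sin (u / 2)\<bar> * \<bar>sin (u / 2)\<bar>)"
      using cos_double_sin[of "u / 2"] by (simp add: power2_eq_square)
    also have "\<dots> \<le> 2 * (1 * \<bar>u / 2\<bar>)"
      by (intro mult_mono abs_sin_le_one abs_sin_x_le_abs_x mult_left_mono) auto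
    finally show ?thesis by simp
  qed
  then have "1 - cos (\<omega> * (y - 1)) \<le> \<omega> * \<bar>y - 1\<bar>"
    using assms(1) by (metis abs_mult abs_of_pos)
  also have "\<dots> \<le> \<omega>\<^sub>0 * \<bar>y - 1\<bar>"
    using assms by (intro mult_right_mono) auto
  finally have "1 - cos (\<omega> * (y - 1)) \<le> \<omega>\<^sub>0 * \<bar>y - 1\<bar>" .
  moreover have "1 - cos (\<omega> * (y - 1)) \<le> \<omega>\<^sub>0"
    using assms cos_ge_minus_one[of "\<omega> * (y - 1)"] by linarith
  ultimately show ?thesis
    by (cases "\<bar>y - 1\<bar> \<le> 1") (auto simp: dev_def)
qed

text \<open>If the mean of the row is below 1/2, then \<open>1 - weight xs bs\<close> has a large
  mean and lies below \<open>dev\<close>. Otherwise sparsity prevents the mass from being spread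
  over many tiny entries, whose sum would concentrate, and the characteristic function is bounded
  away from 1 at some frequency below \<open>\<omega>\<^sub>0\<close>.\<close>

lemma expectation_dev_weight_ge:
  assumes p: "0 < p" "p \<le> 1 / 2" and "2 \<le> \<omega>\<^sub>0"
    and xs: "\<forall>x\<in>set xs. 0 \<le> x \<and> x \<le> 2"
    and sparse: "p * real (card {j. j < length xs \<and> xs ! j \<noteq> 0}) \<le> \<omega>\<^sub>0\<^sup>2"
  shows "1 / (250 * \<omega>\<^sub>0) \<le> measure_pmf.expectation (bits (length xs) p) (\<lambda>bs. dev (weight xs bs))"
proof (cases "p * sum_list xs < 1 / 2")
  case True
  have "1 / (250 * \<omega>\<^sub>0) \<le> 1 / 500"
    using \<open>2 \<le> \<omega>\<^sub>0\<close> by (simp add: field_simps)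
  also have "\<dots> \<le> 1 - p * sum_list xs"
    using True by simp
  also have "\<dots> = measure_pmf.expectation (bits (length xs) p) (\<lambda>bs. 1 - weight xs bs)"
    using p by (simp add: expectation_weight)
  also have "\<dots> \<le> measure_pmf.expectation (bits (length xs) p) (\<lambda>bs. dev (weight xs bs))"
    using xs by (intro integral_mono integrable_bits) (auto simp: dev_def weight_nonneg)
  finally show ?thesis .
next
  case False
  define S where "S = {j. j < length xs \<and> xs ! j \<noteq> 0}"
  have S: "0 < xs ! j \<and> xs ! j \<le> 2" if "j \<in> S" for j
    using xs that unfolding S_def by (metis (mono_tags, lifting) less_eq_real_def mem_Collect_eq nth_mem)
  have "finite S"
    by (simp add: S_def)
  then obtain \<omega> where \<omega>: "0 < \<omega>" "\<omega> < \<omega>\<^sub>0"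
    "(\<Sum>j\<in>S. min 1 ((\<omega>\<^sub>0 * xs ! j)\<^sup>2)) / 10 \<le> (\<Sum>j\<in>S. 1 - cos (\<omega> * xs ! j))"
    using exists_frequency[of S \<omega>\<^sub>0 "(!) xs"] S \<open>2 \<le> \<omega>\<^sub>0\<close> by (metis order_less_le_trans zero_less_numeral)
  \<comment> \<open>A linear minorant obtained by completing the square; the cap at 1 is respected
    because \<open>x \<le> 2\<close>. Summed over the support and multiplied by \<open>p\<close>,
    the subtracted constants cost at most 1/16 by the sparsity bound, against a main term of at
    least 1/4.\<close>
  have min_ge: "x / 2 - 1 / (16 * \<omega>\<^sub>0\<^sup>2) \<le> min 1 ((\<omega>\<^sub>0 * x)\<^sup>2)" if "x \<le> 2" for x
  proof -
    have "0 \<le> (\<omega>\<^sub>0 * x - 1 / (4 * \<omega>\<^sub>0))\<^sup>2"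
      by simp
    also have "\<dots> = (\<omega>\<^sub>0 * x)\<^sup>2 - (x / 2 - 1 / (16 * \<omega>\<^sub>0\<^sup>2))"
      using \<open>2 \<le> \<omega>\<^sub>0\<close> by (simp add: power2_eq_square field_simps)
    finally show ?thesis
      using that by (intro min.boundedI) (auto intro: order_trans[of _ "x / 2"])
  qed
  have sum_S: "sum_list (map f xs) = (\<Sum>j\<in>S. f (xs ! j))" if "f 0 = 0" for f :: "real \<Rightarrow> real"
    unfolding sum_list_sum_nth S_def using that by (intro sum.mono_neutral_cong_right) auto
  have "1 / 2 \<le> p * (\<Sum>j\<in>S. xs ! j)"
    using False sum_S[of id] by simp
  then have "3 / 16 \<le> p * ((\<Sum>j\<in>S. xs ! j) / 2) - 1 / 16"
    by simp
  also have "\<dots> \<le> p * ((\<Sum>j\<in>S. xs ! j) / 2) - p * real (card S) / (16 * \<omega>\<^sub>0\<^sup>2)"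
    using sparse \<open>2 \<le> \<omega>\<^sub>0\<close> by (simp add: S_def field_simps)
  also have "\<dots> = p * (\<Sum>j\<in>S. xs ! j / 2 - 1 / (16 * \<omega>\<^sub>0\<^sup>2))"
    by (simp add: sum_subtractf sum_divide_distrib algebra_simps)
  also have "\<dots> \<le> p * (\<Sum>j\<in>S. min 1 ((\<omega>\<^sub>0 * xs ! j)\<^sup>2))"
    using p S by (intro mult_left_mono sum_mono min_ge) auto
  also have "\<dots> \<le> p * (10 * (\<Sum>j\<in>S. 1 - cos (\<omega> * xs ! j)))"
    using p \<omega> by (intro mult_left_mono) auto
  finally have "3 / 160 \<le> p * (\<Sum>j\<in>S. 1 - cos (\<omega> * xs ! j))"
    by simp
  then have "3 / 160 * (1 / 2) \<le> p * (\<Sum>j\<in>S. 1 - cos (\<omega> * xs ! j)) * (1 - p)"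
    using p by (intro mult_mono) auto
  then have "3 / 320 \<le> p * (1 - p) * (\<Sum>x\<leftarrow>xs. 1 - cos (\<omega> * x))"
    by (simp add: sum_S mult_ac)
  then have "exp (- (p * (1 - p) * (\<Sum>x\<leftarrow>xs. 1 - cos (\<omega> * x)))) \<le> exp (- (3 / 320))"
    by simp
  also have "\<dots> \<le> 1 - 1 / (250 :: real)"
  proof -
    have "1 / (1 + 3 / 320) \<ge> exp (- (3 / 320 :: real))"
      using exp_ge_add_one_self[of "3 / 320"] by (simp add: exp_minus field_simps)
    then show ?thesis
      by simp
  qed
  finally have char: "norm (measure_pmf.expectation (bits (length xs) p) (\<lambda>bs. cis (\<omega> * weight xs bs)))
      \<le> 1 - 1 / 250"
    using norm_expectation_cis_weight_le[of p xs \<omega>] p by simp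
  \<comment> \<open>The factor \<open>cis (- \<omega>)\<close> has norm 1 and recentres the row sum
    at 1, so that the real part becomes the mean of
    \<open>cos (\<omega> * (weight xs bs - 1))\<close>.\<close>
  have "1 / 250 \<le> 1 - norm (cis (- \<omega>) * measure_pmf.expectation (bits (length xs) p) (\<lambda>bs. cis (\<omega> * weight xs bs)))"
    using char by (simp add: norm_mult)
  also have "\<dots> \<le> 1 - Re (cis (- \<omega>) * measure_pmf.expectation (bits (length xs) p) (\<lambda>bs. cis (\<omega> * weight xs bs)))"
    by (intro diff_left_mono complex_Re_le_cmod)
  also have "\<dots> = 1 - measure_pmf.expectation (bits (length xs) p) (\<lambda>bs. Re (cis (- \<omega>) * cis (\<omega> * weight xs bs)))"
    by (subst integral_Re[OF integrable_bits]) simp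
  also have "\<dots> = measure_pmf.expectation (bits (length xs) p) (\<lambda>bs. 1 - cos (\<omega> * (weight xs bs - 1)))"
    by (simp add: cis_mult right_diff_distrib)
  also have "\<dots> \<le> measure_pmf.expectation (bits (length xs) p) (\<lambda>bs. \<omega>\<^sub>0 * dev (weight xs bs))"
    using \<omega> \<open>2 \<le> \<omega>\<^sub>0\<close> by (intro integral_mono integrable_bits one_minus_cos_le_dev) auto
  finally show ?thesis
    using \<open>2 \<le> \<omega>\<^sub>0\<close> by (simp add: field_simps)
qed

section \<open>Independence of the rows and the tail bound for a fixed vector\<close>

text \<open>The system is drawn set by set, whereas independence of the rows is wanted. In the
  induction on the number of sets, the bit of the first set at \<open>i\<close> is absorbed into
  \<open>h i\<close>, which is why \<open>h\<close> is arbitrary; independence of the bits within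
  that set then splits the product.\<close>

lemma expectation_prod_rows:
  fixes m :: nat and h :: "nat \<Rightarrow> bool list \<Rightarrow> real"
  assumes "\<And>i bs. i < m \<Longrightarrow> 0 \<le> h i bs"
  shows "measure_pmf.expectation (replicate_pmf n (map_pmf (\<lambda>f. {i. i < m \<and> f i})
      (Pi_pmf {..<m} False (\<lambda>_. bernoulli_pmf p)))) (\<lambda>F. \<Prod>i<m. h i (map (\<lambda>S. i \<in> S) F)) =
    (\<Prod>i<m. measure_pmf.expectation (bits n p) (h i))"
  using assms
proof (induction n arbitrary: h)
  case (Suc n)
  let ?P = "Pi_pmf {..<m} False (\<lambda>_. bernoulli_pmf p)"
  let ?R = "map_pmf (\<lambda>f. {i. i < m \<and> f i}) ?P"
  have fin: "finite (set_pmf ?P)"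
    by (subst set_Pi_pmf) (auto intro: finite_PiE_dflt)
  then have fin': "finite (set_pmf ?R)"
    by simp
  have "measure_pmf.expectation (replicate_pmf (Suc n) ?R) (\<lambda>F. \<Prod>i<m. h i (map (\<lambda>S. i \<in> S) F)) =
    measure_pmf.expectation ?P (\<lambda>f. measure_pmf.expectation (replicate_pmf n ?R)
      (\<lambda>F. \<Prod>i<m. h i (f i # map (\<lambda>S. i \<in> S) F)))"
    by (rule trans[OF expectation_replicate_pmf_Suc[OF fin']]) simp
  also have "\<dots> = measure_pmf.expectation ?P (\<lambda>f. \<Prod>i<m. measure_pmf.expectation (bits n p) (\<lambda>bs. h i (f i # bs)))"
    using Suc.prems by (subst Suc.IH) auto
  also have "\<dots> = (\<Prod>i<m. measure_pmf.expectation (bernoulli_pmf p)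
      (\<lambda>b. measure_pmf.expectation (bits n p) (\<lambda>bs. h i (b # bs))))"
    using Suc.prems by (intro expectation_prod_Pi_pmf)
      (auto intro!: integral_nonneg integrable_measure_pmf_finite)
  also have "\<dots> = (\<Prod>i<m. measure_pmf.expectation (bits (Suc n) p) (h i))"
    by (subst expectation_replicate_pmf_Suc) simp_all
  finally show ?case .
qed simp


lemma finite_set_no_case: "finite (set_pmf (no_case m k n))"
  unfolding no_case_def random_set_def
  by (intro finite_set_replicate_pmf)
    (auto simp: set_Pi_pmf intro!: finite_imageI finite_PiE_dflt)

text \<open>A Chernoff argument with \<open>exp (- Z)\<close>, where \<open>Z\<close> is the total
  deviation: each row contributes a factor of at most \<open>exp (- 4 * \<epsilon>)\<close>, and
  Markov's inequality at the level \<open>2 * \<epsilon> * m\<close> gives back only half of the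
  exponent.\<close>

lemma prob_sum_dev_weight_le:
  assumes "2 \<le> k" "0 < \<epsilon>" "\<epsilon> \<le> 1 / 4000" "length xs = n"
    and xs: "\<forall>x\<in>set xs. 0 \<le> x \<and> x \<le> 2"
    and sparse: "real (card {j. j < length xs \<and> xs ! j \<noteq> 0}) \<le> real k / (2000 * \<epsilon>)\<^sup>2"
  shows "measure_pmf.prob (no_case m k n)
      {F. (\<Sum>i<m. dev (weight xs (map (\<lambda>S. i \<in> S) F))) \<le> 2 * \<epsilon> * real m} \<le> exp (- 2 * \<epsilon> * real m)"
proof -
  let ?p = "1 / real k"
  let ?Z = "\<lambda>F. \<Sum>i<m. dev (weight xs (map (\<lambda>S. i \<in> S) F))"
  have exp_le: "exp (- g) \<le> 1 - g / 2" if "0 \<le> g" "g \<le> 1" for g :: real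
  proof -
    have "exp (- g) \<le> 1 / (1 + g)"
      using exp_ge_add_one_self[of g] that by (simp add: exp_minus field_simps)
    also have "\<dots> \<le> 1 - g / 2"
      using that mult_left_mono[of g 1 g] by (simp add: field_simps)
    finally show ?thesis .
  qed
  \<comment> \<open>The frequency bound is chosen as \<open>1 / (2000 * \<epsilon>)\<close>: the row
    mean is then at least \<open>8 * \<epsilon>\<close>, and
    \<open>\<epsilon> \<le> 1 / 4000\<close> makes the bound at least 2.\<close>
  have "1 / (250 * (1 / (2000 * \<epsilon>))) \<le> measure_pmf.expectation (bits (length xs) ?p) (\<lambda>bs. dev (weight xs bs))"
    using assms by (intro expectation_dev_weight_ge) (auto simp: field_simps)
  then have "8 * \<epsilon> \<le> measure_pmf.expectation (bits n ?p) (\<lambda>bs. dev (weight xs bs))"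
    using assms(4) by simp
  then have "1 - measure_pmf.expectation (bits n ?p) (\<lambda>bs. dev (weight xs bs)) / 2 \<le> 1 - 4 * \<epsilon>"
    by simp
  moreover have "measure_pmf.expectation (bits n ?p) (\<lambda>bs. exp (- dev (weight xs bs))) \<le>
      measure_pmf.expectation (bits n ?p) (\<lambda>bs. 1 - dev (weight xs bs) / 2)"
    by (intro integral_mono integrable_bits exp_le dev_nonneg dev_le_1)
  moreover have "1 - 4 * \<epsilon> \<le> exp (- 4 * \<epsilon>)"
    using exp_ge_add_one_self[of "- 4 * \<epsilon>"] by simp
  ultimately have row: "measure_pmf.expectation (bits n ?p) (\<lambda>bs. exp (- dev (weight xs bs))) \<le> exp (- 4 * \<epsilon>)"
    by simp
  have int: "integrable (measure_pmf (no_case m k n)) f" for f :: "nat set list \<Rightarrow> real"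
    by (rule integrable_measure_pmf_finite[OF finite_set_no_case])
  have "measure_pmf.prob (no_case m k n) {F. ?Z F \<le> 2 * \<epsilon> * real m} =
      measure_pmf.expectation (no_case m k n) (indicator {F. ?Z F \<le> 2 * \<epsilon> * real m})"
    by simp
  also have "\<dots> \<le> measure_pmf.expectation (no_case m k n) (\<lambda>F. exp (2 * \<epsilon> * real m) * exp (- ?Z F))"
    by (intro integral_mono int) (auto simp: indicator_def simp flip: exp_add)
  also have "\<dots> = exp (2 * \<epsilon> * real m) * measure_pmf.expectation (no_case m k n)
      (\<lambda>F. \<Prod>i<m. exp (- dev (weight xs (map (\<lambda>S. i \<in> S) F))))"
    by (simp add: exp_sum sum_negf[symmetric] del: sum_negf)
  also have "\<dots> = exp (2 * \<epsilon> * real m) *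
      (\<Prod>i<m. measure_pmf.expectation (bits n ?p) (\<lambda>bs. exp (- dev (weight xs bs))))"
    unfolding no_case_def random_set_def by (subst expectation_prod_rows) auto
  also have "\<dots> \<le> exp (2 * \<epsilon> * real m) * exp (- 4 * \<epsilon>) ^ m"
    using row by (simp add: power_mono)
  also have "\<dots> = exp (- 2 * \<epsilon> * real m)"
    by (simp flip: exp_of_nat_mult exp_add)
  finally show ?thesis .
qed

section \<open>From approximate solutions to a finite grid of vectors\<close>

lemma weight_conv_sum:
  "length xs = length bs \<Longrightarrow> weight xs bs = (\<Sum>j<length xs. if bs ! j then xs ! j else 0)"
  by (induction xs bs rule: list_induct2) (simp_all add: sum.lessThan_Suc_shift del: sum.lessThan_Suc cong: if_cong)

lemma incidence_mat_mult_index: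
  assumes "i < m" "dim_vec x = length F"
  shows "(incidence_mat m F *\<^sub>v x) $ i = weight (list_of_vec x) (map (\<lambda>S. i \<in> S) F)"
proof -
  have "(incidence_mat m F *\<^sub>v x) $ i = (\<Sum>j<length F. (if i \<in> F ! j then 1 else 0) * x $ j)"
    using assms by (simp add: incidence_mat_def scalar_prod_def lessThan_atLeast0)
  also have "\<dots> = weight (list_of_vec x) (map (\<lambda>S. i \<in> S) F)"
    using assms by (subst weight_conv_sum) (auto simp: list_of_vec_index intro!: sum.cong)
  finally show ?thesis .
qed

text \<open>Once an entry above 2 is picked, both sums are at least 2 and the deviation is 1 either way.\<close>

lemma dev_weight_truncate_le:
  assumes "\<forall>x\<in>set xs. 0 \<le> x"
  shows "dev (weight (map (min 2) xs) bs) \<le> \<bar>weight xs bs - 1\<bar>"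
proof -
  have "weight (map (min 2) xs) bs = weight xs bs \<or>
      2 \<le> weight (map (min 2) xs) bs \<and> 2 \<le> weight xs bs"
    using assms
  proof (induction xs bs rule: weight.induct)
    case (1 x xs b bs)
    then show ?case
      using weight_nonneg[of xs bs] weight_nonneg[of "map (min 2) xs" bs] by (auto simp: min_def)
  qed auto
  then show ?thesis
    by (auto simp: dev_def)
qed

text \<open>As \<open>f\<close> fixes 0, only nonzero entries can move, so the error scales with the
  sparsity and not with the length.\<close>

lemma weight_map_diff_le:
  assumes "\<forall>x\<in>set xs. \<bar>f x - x\<bar> \<le> \<eta>" "f 0 = 0"
  shows "\<bar>weight (map f xs) bs - weight xs bs\<bar> \<le> \<eta> * real (length (filter (\<lambda>x. x \<noteq> 0) xs))"
  using assms
proof (induction xs bs rule: weight.induct)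
  case (1 x xs b bs)
  have "0 \<le> \<eta>"
    using "1.prems"(1) by (force intro: order_trans[OF abs_ge_zero])
  have "\<bar>weight (map f xs) bs - weight xs bs\<bar> \<le> \<eta> * real (length (filter (\<lambda>x. x \<noteq> 0) xs))"
    using 1 by simp
  moreover have "\<bar>f x - x\<bar> \<le> \<eta>" "x = 0 \<Longrightarrow> f x = x"
    using "1.prems" by auto
  ultimately show ?case
    using \<open>0 \<le> \<eta>\<close> unfolding list.map weight.simps filter.simps
    by (cases b; cases "x = 0") (simp_all add: distrib_left; linarith)+
next
  case ("2_1" bs)
  then show ?case by simp
next
  case ("2_2" xs)
  \<comment> \<open>With no bits left both weights are 0, and only the sign of the right-hand side
    matters; \<open>0 \<le> \<eta>\<close> is read off from any entry.\<close>
  then have "xs \<noteq> [] \<Longrightarrow> 0 \<le> \<eta>"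
    by (metis abs_ge_zero hd_in_set order_trans)
  then show ?case
    by (cases xs) simp_all
qed

lemma dev_lipschitz: "dev y \<le> dev z + \<bar>y - z\<bar>"
  by (auto simp: dev_def)

text \<open>Rounding downwards keeps 0 at 0 and never leaves the interval from 0 to 2, so neither
  the support nor the range of the entries grows.\<close>

definition round_down :: "nat \<Rightarrow> real \<Rightarrow> real" where
  "round_down M x = real (nat \<lfloor>x * real M\<rfloor>) / real M"

lemma round_down_diff:
  assumes "0 < M" "0 \<le> x"
  shows "\<bar>round_down M x - x\<bar> \<le> 1 / real M"
proof -
  have "real (nat \<lfloor>x * real M\<rfloor>) = of_int \<lfloor>x * real M\<rfloor>"
    using assms by simp
  then have "\<bar>real (nat \<lfloor>x * real M\<rfloor>) - x * real M\<bar> \<le> 1"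
    by linarith
  moreover have "round_down M x - x = (real (nat \<lfloor>x * real M\<rfloor>) - x * real M) / real M"
    using assms by (simp add: round_down_def field_simps)
  ultimately show ?thesis
    using assms by (simp add: divide_right_mono)
qed

definition grid_vectors :: "nat \<Rightarrow> nat \<Rightarrow> nat \<Rightarrow> real list set" where
  "grid_vectors M n T = {xs. length xs = n \<and> set xs \<subseteq> (\<lambda>i. real i / real M) ` {..2 * M} \<and>
     card {j. j < length xs \<and> xs ! j \<noteq> 0} \<le> T}"

text \<open>A sparse vector is determined by \<open>T\<close> pairs of a position and a value, and
  each pair has at most \<open>n * (2 * M + 1)\<close> choices.\<close>

lemma card_grid_vectors_le:
  assumes "0 < n"
  shows "finite (grid_vectors M n T)" "card (grid_vectors M n T) \<le> (n * (2 * M + 1)) ^ T"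
proof -
  define V where "V = (\<lambda>i. real i / real M) ` {..2 * M}"
  \<comment> \<open>Decoding reads the pairs as a lookup table with default 0. Repeated positions do
    no harm, because every pair made below carries the true entry at its position.\<close>
  define \<psi> where "\<psi> ps = map (\<lambda>j. case map_of ps j of Some v \<Rightarrow> v | None \<Rightarrow> 0) [0..<n]"
    for ps :: "(nat \<times> real) list"
  define L where "L = {ps. set ps \<subseteq> {..<n} \<times> V \<and> length ps = T}"
  have V: "finite V" "card V \<le> 2 * M + 1"
    unfolding V_def using card_image_le[of "{..2 * M}" "\<lambda>i. real i / real M"] by auto
  have sub: "grid_vectors M n T \<subseteq> \<psi> ` L"
  proof
    fix xs assume xs: "xs \<in> grid_vectors M n T"
    define J where "J = {j. j < length xs \<and> xs ! j \<noteq> 0}"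
    \<comment> \<open>padded with the index 0 to reach length exactly \<open>T\<close>\<close>
    define js where "js = sorted_list_of_set J @ replicate (T - card J) 0"
    define ps where "ps = map (\<lambda>j. (j, xs ! j)) js"
    have len: "length xs = n" and "card J \<le> T" and V: "set xs \<subseteq> V"
      using xs by (auto simp: grid_vectors_def J_def V_def)
    have J: "finite J" "J \<subseteq> {..<n}"
      using len by (auto simp: J_def)
    have js: "set js \<subseteq> {..<n}" "J \<subseteq> set js" "length js = T"
      using J \<open>0 < n\<close> \<open>card J \<le> T\<close> by (auto simp: js_def)
    have "ps \<in> L"
      using js V len by (auto simp: L_def ps_def intro!: subsetD[OF V] nth_mem)
    moreover have "\<psi> ps = xs"
      using len js by (intro nth_equalityI)
        (auto simp: \<psi>_def ps_def map_of_map_restrict restrict_map_def J_def subset_iff)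
    ultimately show "xs \<in> \<psi> ` L"
      by blast
  qed
  have L: "finite L" "card L = (n * card V) ^ T"
    using V card_lists_length_eq[of "{..<n} \<times> V" T] finite_lists_length_eq[of "{..<n} \<times> V" T]
    by (auto simp: L_def)
  show "finite (grid_vectors M n T)"
    using sub L finite_subset by blast
  have "card (grid_vectors M n T) \<le> card L"
    using sub L by (meson card_image_le card_mono finite_imageI le_trans)
  also have "\<dots> \<le> (n * (2 * M + 1)) ^ T"
    unfolding L using V by (intro power_mono mult_left_mono) auto
  finally show "card (grid_vectors M n T) \<le> (n * (2 * M + 1)) ^ T" .
qed

text \<open>Truncating the entries at 2 costs nothing in terms of \<open>dev\<close>. Rounding to
  multiples of \<open>1 / m\<^sup>2\<close> changes a row by at most
  \<open>T / m\<^sup>2 \<le> \<epsilon>\<close>, which accounts for the second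
  \<open>\<epsilon> * m\<close>.\<close>

lemma approx_solution_imp_grid_vector:
  assumes sol: "approx_solution \<epsilon> (incidence_mat m F) (ones_vec m) x"
    and "sparse (real T) x" "0 < m" "real T \<le> \<epsilon> * (real m)\<^sup>2"
  shows "\<exists>xs \<in> grid_vectors (m\<^sup>2) (length F) T.
    (\<Sum>i<m. dev (weight xs (map (\<lambda>S. i \<in> S) F))) \<le> 2 * \<epsilon> * real m"
proof (intro bexI)
  let ?M = "m\<^sup>2"
  let ?f = "round_down ?M"
  define ys where "ys = map (min 2) (list_of_vec x)"
  define xs where "xs = map ?f ys"
  have dim: "dim_vec x = length F" and nonneg: "\<forall>v\<in>set (list_of_vec x). 0 \<le> v"
    and l1: "l1_norm (incidence_mat m F *\<^sub>v x - ones_vec m) \<le> \<epsilon> * l1_norm (ones_vec m)"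
    using sol by (auto simp: approx_solution_def incidence_mat_def nonneg_vec_def
        set_list_of_vec vec_set_def)
  have ys: "\<forall>y\<in>set ys. 0 \<le> y \<and> y \<le> 2"
    using nonneg by (auto simp: ys_def)
  have supp: "card {j. j < length ys \<and> ys ! j \<noteq> 0} \<le> T"
  proof -
    have "{j. j < length ys \<and> ys ! j \<noteq> 0} \<subseteq> {j. j < dim_vec x \<and> x $ j \<noteq> 0}"
      by (auto simp: ys_def list_of_vec_index)
    then have "card {j. j < length ys \<and> ys ! j \<noteq> 0} \<le> card {j. j < dim_vec x \<and> x $ j \<noteq> 0}"
      by (intro card_mono) auto
    then show ?thesis
      using \<open>sparse (real T) x\<close> by (simp add: sparse_def)
  qed
  have f0: "?f 0 = 0"
    by (simp add: round_down_def)
  have in_grid: "?f y \<in> (\<lambda>i. real i / real ?M) ` {..2 * ?M}" if "0 \<le> y" "y \<le> 2" for y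
  proof -
    have "y * real ?M \<le> 2 * real ?M"
      using that by (intro mult_right_mono) auto
    then have "\<lfloor>y * real ?M\<rfloor> \<le> int (2 * ?M)"
      by (simp add: floor_le_iff)
    then have "nat \<lfloor>y * real ?M\<rfloor> \<le> 2 * ?M"
      by (simp only: nat_le_iff)
    then show ?thesis
      by (auto simp: round_down_def)
  qed
  have "{j. j < length xs \<and> xs ! j \<noteq> 0} \<subseteq> {j. j < length ys \<and> ys ! j \<noteq> 0}"
    using f0 by (auto simp: xs_def)
  then have "card {j. j < length xs \<and> xs ! j \<noteq> 0} \<le> T"
    by (intro order_trans[OF card_mono supp]) auto
  moreover have "set xs \<subseteq> (\<lambda>i. real i / real ?M) ` {..2 * ?M}"
    unfolding xs_def set_map using ys in_grid by blast
  moreover have "length xs = length F"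
    using dim by (simp add: xs_def ys_def)
  ultimately show "xs \<in> grid_vectors ?M (length F) T"
    unfolding grid_vectors_def by blast
  have row: "dev (weight xs bs) \<le> \<bar>weight (list_of_vec x) bs - 1\<bar> + \<epsilon>" for bs
  proof -
    have "\<bar>weight xs bs - weight ys bs\<bar> \<le> 1 / real ?M * real (length (filter (\<lambda>y. y \<noteq> 0) ys))"
      unfolding xs_def using \<open>0 < m\<close> ys f0 by (intro weight_map_diff_le ballI round_down_diff) auto
    also have "\<dots> \<le> 1 / real ?M * real T"
      using supp by (intro mult_left_mono) (auto simp: length_filter_conv_card)
    also have "\<dots> \<le> \<epsilon>"
      using assms(3,4) by (simp add: field_simps)
    finally show ?thesis
      using dev_lipschitz[of "weight xs bs" "weight ys bs"]
        dev_weight_truncate_le[OF nonneg, of bs] by (simp add: ys_def)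
  qed
  have "(\<Sum>i<m. dev (weight xs (map (\<lambda>S. i \<in> S) F))) \<le>
      (\<Sum>i<m. \<bar>weight (list_of_vec x) (map (\<lambda>S. i \<in> S) F) - 1\<bar> + \<epsilon>)"
    by (intro sum_mono row)
  also have "\<dots> = l1_norm (incidence_mat m F *\<^sub>v x - ones_vec m) + \<epsilon> * real m"
  proof -
    have "l1_norm (incidence_mat m F *\<^sub>v x - ones_vec m) =
        (\<Sum>i<m. \<bar>weight (list_of_vec x) (map (\<lambda>S. i \<in> S) F) - 1\<bar>)"
      unfolding l1_norm_def by (intro sum.cong)
        (simp_all add: ones_vec_def incidence_mat_mult_index[OF _ dim, symmetric])
    then show ?thesis
      by (simp add: sum.distrib)
  qed
  also have "\<dots> \<le> 2 * \<epsilon> * real m"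
    using l1 by (simp add: l1_norm_def ones_vec_def)
  finally show "(\<Sum>i<m. dev (weight xs (map (\<lambda>S. i \<in> S) F))) \<le> 2 * \<epsilon> * real m" .
qed

section \<open>Union bound for random systems\<close>

lemma prob_no_case_sparse_solution_le:
  assumes "2 \<le> k" "0 < n" "0 < m" "0 < \<epsilon>" "\<epsilon> \<le> 1 / 4000"
    and T: "real T \<le> real k / (2000 * \<epsilon>)\<^sup>2" "real T \<le> \<epsilon> * (real m)\<^sup>2"
  shows "measure_pmf.prob (no_case m k n)
      {F. \<exists>x. approx_solution \<epsilon> (incidence_mat m F) (ones_vec m) x \<and> sparse (real T) x}
    \<le> real ((n * (2 * m\<^sup>2 + 1)) ^ T) * exp (- 2 * \<epsilon> * real m)"
    (is "measure_pmf.prob ?D ?B \<le> _")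
proof -
  let ?G = "grid_vectors (m\<^sup>2) n T"
  let ?E = "\<lambda>xs. {F. (\<Sum>i<m. dev (weight xs (map (\<lambda>S. i \<in> S) F))) \<le> 2 * \<epsilon> * real m}"
  note G = card_grid_vectors_le[OF \<open>0 < n\<close>, of "m\<^sup>2" T]
  \<comment> \<open>The grid is built for length \<open>n\<close>, and only systems in the support
    are known to have that length.\<close>
  have "?B \<inter> set_pmf ?D \<subseteq> (\<Union>xs\<in>?G. ?E xs)"
  proof
    fix F assume F: "F \<in> ?B \<inter> set_pmf ?D"
    then have "length F = n"
      by (simp add: no_case_def set_replicate_pmf)
    moreover obtain x where "approx_solution \<epsilon> (incidence_mat m F) (ones_vec m) x" "sparse (real T) x"
      using F by blast
    ultimately show "F \<in> (\<Union>xs\<in>?G. ?E xs)"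
      using approx_solution_imp_grid_vector[of \<epsilon> m F x T] \<open>0 < m\<close> T(2) by blast
  qed
  then have "measure_pmf.prob ?D ?B \<le> measure_pmf.prob ?D (\<Union>xs\<in>?G. ?E xs)"
    by (subst measure_Int_set_pmf[symmetric]) (rule measure_pmf.finite_measure_mono, auto)
  also have "\<dots> \<le> (\<Sum>xs\<in>?G. measure_pmf.prob ?D (?E xs))"
    using G by (intro measure_pmf.finite_measure_subadditive_finite) auto
  also have "\<dots> \<le> (\<Sum>xs\<in>?G. exp (- 2 * \<epsilon> * real m))"
  proof (intro sum_mono prob_sum_dev_weight_le ballI)
    fix xs assume xs: "xs \<in> ?G"
    then show "length xs = n"
      by (simp add: grid_vectors_def)
    show "real (card {j. j < length xs \<and> xs ! j \<noteq> 0}) \<le> real k / (2000 * \<epsilon>)\<^sup>2"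
      using xs T by (auto simp: grid_vectors_def)
    fix v assume "v \<in> set xs"
    then obtain i where "v = real i / real (m\<^sup>2)" "i \<le> 2 * m\<^sup>2"
      using xs by (auto simp: grid_vectors_def)
    moreover from this have "real i \<le> 2 * real (m\<^sup>2)"
      by linarith
    ultimately show "0 \<le> v \<and> v \<le> 2"
      using \<open>0 < m\<close> by (simp add: divide_le_eq)
  qed (use assms in auto)
  also have "\<dots> = real (card ?G) * exp (- 2 * \<epsilon> * real m)"
    by simp
  also have "\<dots> \<le> real ((n * (2 * m\<^sup>2 + 1)) ^ T) * exp (- 2 * \<epsilon> * real m)"
    using G by (intro mult_right_mono) (auto simp flip: of_nat_power of_nat_mult)
  finally show ?thesis .
qed

section \<open>Sparse exact solutions of planted systems\<close>

lemma partition_imp_exact_solution: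
  assumes P: "partition_on {..<m} P" and "P \<subseteq> set F"
  shows "\<exists>x. exact_solution (incidence_mat m F) (ones_vec m) x \<and> sparse (real (card P)) x"
proof -
  \<comment> \<open>A block may occur several times in \<open>F\<close>. Choosing a single position
    for each block keeps the row sums equal to 1.\<close>
  have "\<forall>S\<in>P. \<exists>j. j < length F \<and> F ! j = S"
    using \<open>P \<subseteq> set F\<close> by (metis in_set_conv_nth subsetD)
  then obtain idx where idx: "\<And>S. S \<in> P \<Longrightarrow> idx S < length F" "\<And>S. S \<in> P \<Longrightarrow> F ! idx S = S"
    by metis
  have "finite P"
    using \<open>P \<subseteq> set F\<close> finite_subset by blast
  have inj: "inj_on idx P"
    using idx(2) by (metis inj_onI)
  define x :: "real vec" where "x = vec (length F) (\<lambda>j. if j \<in> idx ` P then 1 else 0)"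
  have "(incidence_mat m F *\<^sub>v x) $ i = 1" if "i < m" for i
  proof -
    obtain S where S: "S \<in> P" "i \<in> S"
      using P \<open>i < m\<close> by (metis UnionE lessThan_iff partition_onD1)
    have "(incidence_mat m F *\<^sub>v x) $ i =
        (\<Sum>j<length F. (if i \<in> F ! j then 1 else 0) * (if j \<in> idx ` P then 1 else 0))"
      using \<open>i < m\<close> by (simp add: incidence_mat_def x_def scalar_prod_def lessThan_atLeast0)
    also have "\<dots> = (\<Sum>j\<in>idx ` P. if i \<in> F ! j then 1 else 0)"
      using idx(1) by (intro sum.mono_neutral_cong_right) auto
    also have "\<dots> = (\<Sum>S'\<in>P. if i \<in> S' then 1 else 0)"
      using inj idx(2) by (simp add: sum.reindex)
    also have "\<dots> = (\<Sum>S'\<in>P. if S' = S then 1 else 0)"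
      using S partition_onD2[OF P] by (intro sum.cong) (auto simp: disjoint_def)
    also have "\<dots> = 1"
      using S \<open>finite P\<close> by simp
    finally show ?thesis .
  qed
  then have "incidence_mat m F *\<^sub>v x = ones_vec m"
    by (intro eq_vecI) (auto simp: ones_vec_def incidence_mat_def)
  then have "exact_solution (incidence_mat m F) (ones_vec m) x"
    by (auto simp: exact_solution_def incidence_mat_def x_def nonneg_vec_def)
  moreover have "sparse (real (card P)) x"
  proof -
    have "{j. j < dim_vec x \<and> x $ j \<noteq> 0} \<subseteq> idx ` P"
      by (auto simp: x_def split: if_splits)
    then have "card {j. j < dim_vec x \<and> x $ j \<noteq> 0} \<le> card P"
      using \<open>finite P\<close> by (meson card_image_le card_mono finite_imageI le_trans)
    then show ?thesis
      by (simp add: sparse_def)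
  qed
  ultimately show ?thesis
    by blast
qed

text \<open>This makes the set of partitions in \<open>yes_case\<close> nonempty, so that the
  support of its uniform distribution is known.\<close>

lemma exists_partition_on_card:
  assumes "0 < k" "k \<le> m"
  shows "\<exists>P. partition_on {..<m} P \<and> card P = k"
proof -
  \<comment> \<open>The blocks are the singletons below \<open>k - 1\<close>, and one last block
    with all remaining elements.\<close>
  define B where "B j = {i. i < m \<and> min i (k - 1) = j}" for j
  have mem: "j \<in> B j" if "j < k" for j
    using that assms by (auto simp: B_def)
  have "partition_on {..<m} (B ` {..<k})"
  proof (rule partition_onI)
    show "\<Union> (B ` {..<k}) = {..<m}"
      using assms by (fastforce simp: B_def)
    show "{} \<notin> B ` {..<k}"
      using mem by auto
  qed (auto simp: B_def disjnt_def)
  moreover have "inj_on B {..<k}"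
  proof (rule inj_onI)
    fix i j assume "i \<in> {..<k}" "j \<in> {..<k}" "B i = B j"
    with mem have "i \<in> B j" "i \<in> B i"
      by auto
    then show "i = j"
      by (simp add: B_def)
  qed
  ultimately show ?thesis
    by (metis card_image card_lessThan)
qed

lemma yes_case_exact_solution:
  assumes "0 < k" "k \<le> m" and F: "F \<in> set_pmf (yes_case m k n)"
  shows "\<exists>x. exact_solution (incidence_mat m F) (ones_vec m) x \<and> sparse (real k) x"
proof -
  have "set_pmf (pmf_of_set {P. partition_on {..<m} P \<and> card P = k}) = {P. partition_on {..<m} P \<and> card P = k}"
    using exists_partition_on_card[OF assms(1,2)] finitely_many_partition_on[of "{..<m}"]
    by (intro set_pmf_of_set) auto
  moreover have "set_pmf (pmf_of_set (permutations_of_multiset A)) = permutations_of_multiset A"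
    for A :: "nat set multiset"
    by (intro set_pmf_of_set) auto
  ultimately obtain F\<^sub>0 P where P: "partition_on {..<m} P" "card P = k"
    and perm: "F \<in> permutations_of_multiset (mset F\<^sub>0 + mset_set P)"
    using F by (auto simp: yes_case_def)
  have "mset F = mset F\<^sub>0 + mset_set P"
    using perm by (simp add: permutations_of_multiset_def)
  moreover have "finite P"
    using P(2) \<open>0 < k\<close> card_gt_0_iff by blast
  ultimately have "P \<subseteq> set F"
    by (metis finite_set_mset_mset_set mset_subset_eq_add_right set_mset_mono set_mset_mset)
  then show ?thesis
    using partition_imp_exact_solution[OF P(1)] P(2) by blast
qed

section \<open>Asymptotics of the union bound\<close>

lemma union_bound_tendsto:
  fixes a \<epsilon> :: real
  assumes "0 < a" "0 < \<epsilon>"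
  shows "((\<lambda>m. exp (4 * a * real m / ln (real m)) * exp (- 2 * \<epsilon> * real m)) \<longlongrightarrow> 0) at_top"
  using assms by real_asymp

text \<open>The grid has at most \<open>(m ^ 4) ^ T\<close> vectors once \<open>m \<ge> 3\<close>.
  Of the two logarithms in the bound on \<open>k\<close>, one cancels the \<open>ln m\<close> from
  this count, and the other makes the exponent \<open>o(m)\<close>, which the tail
  \<open>exp (- 2 * \<epsilon> * m)\<close> beats.\<close>

lemma union_bound_eventually:
  fixes k n :: "nat \<Rightarrow> nat" and a \<epsilon> :: real
  assumes "0 < a" "0 < \<epsilon>"
    and k: "\<forall>\<^sub>F m in at_top. real (k m) < real m / (ln (real m))\<^sup>2"
    and n: "\<forall>\<^sub>F m in at_top. n m \<le> m"
  shows "\<forall>\<^sub>F m in at_top. a * real (k m) \<le> \<epsilon> * (real m)\<^sup>2 \<and>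
    real ((n m * (2 * m\<^sup>2 + 1)) ^ nat \<lfloor>a * real (k m)\<rfloor>) * exp (- 2 * \<epsilon> * real m) < 1 / 3"
proof -
  have "\<forall>\<^sub>F m in at_top. a * (real m / (ln (real m))\<^sup>2) \<le> \<epsilon> * (real m)\<^sup>2"
    using assms(1,2) by real_asymp
  moreover have "\<forall>\<^sub>F m in at_top. exp (4 * a * real m / ln (real m)) * exp (- 2 * \<epsilon> * real m) < 1 / 3"
    using order_tendstoD(2)[OF union_bound_tendsto[OF assms(1,2)], of "1 / 3"] by simp
  ultimately show ?thesis
    using k n eventually_ge_at_top[of 3]
  proof eventually_elim
    case (elim m)
    let ?T = "nat \<lfloor>a * real (k m)\<rfloor>"
    have "ln (real m) > 0"
      using elim by simp
    have ak: "a * real (k m) \<le> a * (real m / (ln (real m))\<^sup>2)"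
      using elim \<open>0 < a\<close> by (intro mult_left_mono) auto
    have "n m * (2 * m\<^sup>2 + 1) \<le> m * (m * m\<^sup>2)"
    proof (intro mult_mono)
      have "2 * m\<^sup>2 + 1 \<le> 3 * m\<^sup>2"
        using elim by simp
      also have "\<dots> \<le> m * m\<^sup>2"
        using elim by (intro mult_right_mono) auto
      finally show "2 * m\<^sup>2 + 1 \<le> m * m\<^sup>2" .
    qed (use elim in auto)
    also have "\<dots> = m ^ 4"
      by (simp add: eval_nat_numeral)
    finally have "(n m * (2 * m\<^sup>2 + 1)) ^ ?T \<le> (m ^ 4) ^ ?T"
      by (rule power_mono) simp
    then have "real ((n m * (2 * m\<^sup>2 + 1)) ^ ?T) \<le> real ((m ^ 4) ^ ?T)"
      by (simp only: of_nat_le_iff)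
    also have "\<dots> = exp (4 * real ?T * ln (real m))"
      using elim exp_of_nat_mult[of "4 * ?T" "ln (real m)"] by (simp flip: power_mult)
    also have "\<dots> \<le> exp (4 * a * real m / ln (real m))"
    proof -
      have "real ?T \<le> a * real (k m)"
        using \<open>0 < a\<close> by simp
      then have "real ?T * ln (real m) \<le> a * (real m / (ln (real m))\<^sup>2) * ln (real m)"
        using ak \<open>ln (real m) > 0\<close> by (intro mult_right_mono) auto
      also have "\<dots> = a * real m / ln (real m)"
        using \<open>ln (real m) > 0\<close> by (simp add: power2_eq_square)
      finally show ?thesis
        by simp
    qed
    finally have "real ((n m * (2 * m\<^sup>2 + 1)) ^ ?T) * exp (- 2 * \<epsilon> * real m) \<le>
        exp (4 * a * real m / ln (real m)) * exp (- 2 * \<epsilon> * real m)"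
      by (intro mult_right_mono) auto
    then show ?case
      using elim ak by linarith
  qed
qed

section \<open>Choice of the accuracy and correctness of the test\<close>

theorem theorem6:
  fixes k n :: "nat \<Rightarrow> nat" and alg :: solver and s :: "nat \<Rightarrow> real \<Rightarrow> real"
  assumes k_range: "\<forall>\<^sub>F m in at_top.
      real m powr (3 / 4) < real (k m) \<and> real (k m) < real m / (ln (real m))\<^sup>2"
    and n_size: "(\<lambda>m. real (n m)) \<in> O[at_top](\<lambda>m. real m / ln (real m))"
    and k_le_n: "\<forall>\<^sub>F m in at_top. k m \<le> n m"
    and alg: "finds_sparse_solutions alg s"
    and s_small: "(\<lambda>(k, \<epsilon>). s k \<epsilon>) \<in> o[at_top \<times>\<^sub>F at_right 0](\<lambda>(k, \<epsilon>). real k / \<epsilon>\<^sup>2)"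
  shows "can_solve_planted_set_cover alg k n"
proof -
  define c :: real where "c = 1 / 2000\<^sup>2"
  have "\<forall>\<^sub>F (k, \<epsilon>) in at_top \<times>\<^sub>F at_right 0. \<bar>s k \<epsilon>\<bar> \<le> c * \<bar>real k / \<epsilon>\<^sup>2\<bar>"
    using landau_o.smallD[OF s_small, of c] by (simp add: c_def case_prod_unfold)
  \<comment> \<open>The product filter separates the conditions: \<open>Q\<close> allows one
    \<open>\<epsilon>\<close> to be fixed independently of \<open>m\<close>, and \<open>P\<close>
    holds at \<open>k m\<close> for all large \<open>m\<close>, because \<open>k\<close> tends to
    infinity.\<close>
  then obtain P Q where P: "eventually P at_top" and Q: "eventually Q (at_right 0)"
    and s: "\<And>k \<epsilon>. P k \<Longrightarrow> Q \<epsilon> \<Longrightarrow> \<bar>s k \<epsilon>\<bar> \<le> c * \<bar>real k / \<epsilon>\<^sup>2\<bar>"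
    unfolding eventually_prod_filter by auto
  have "\<forall>\<^sub>F \<epsilon> in at_right 0. Q \<epsilon> \<and> 0 < \<epsilon> \<and> \<epsilon> \<le> (1 / 4000 :: real)"
    using Q eventually_at_right_less[of "0 :: real"]
      eventually_at_right_real[of 0 "1 / 4000 :: real"]
    by (auto elim: eventually_elim2 simp: eventually_conj_iff)
  then obtain \<epsilon> where \<epsilon>: "Q \<epsilon>" "0 < \<epsilon>" "\<epsilon> \<le> 1 / 4000"
    using eventually_happens' trivial_limit_at_right_real by blast
  define a where "a = 1 / (2000 * \<epsilon>)\<^sup>2"
  have t_eq: "c * real j / \<epsilon>\<^sup>2 = a * real j" for j
    by (simp add: a_def c_def power_mult_distrib)
  have "0 < a"
    using \<epsilon> by (simp add: a_def)
  have k_lower: "\<forall>\<^sub>F m in at_top. real m powr (3 / 4) \<le> real (k m)"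
    using k_range by eventually_elim simp
  have "filterlim (\<lambda>m. real m powr (3 / 4)) at_top at_top"
    by real_asymp
  then have "filterlim (\<lambda>m. real (k m)) at_top at_top"
    using k_lower by (rule filterlim_at_top_mono)
  then have k_lim: "filterlim k at_top at_top"
    by (simp add: filterlim_sequentially_iff_filterlim_real)
  have k_ev: "\<forall>\<^sub>F m in at_top. P (k m)" "\<forall>\<^sub>F m in at_top. 2 \<le> k m"
    using eventually_compose_filterlim[OF P k_lim]
      eventually_compose_filterlim[OF eventually_ge_at_top[of 2] k_lim] by auto
  have "\<forall>\<^sub>F m in at_top. real (n m) \<le> real m"
  proof -
    obtain C where "C > 0" and C: "\<forall>\<^sub>F m in at_top. norm (real (n m)) \<le> C * norm (real m / ln (real m))"
      using landau_o.bigE[OF n_size] by blast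
    have "\<forall>\<^sub>F m in at_top. C * (real m / ln (real m)) \<le> real m"
      using \<open>C > 0\<close> by real_asymp
    then show ?thesis
      using C eventually_ge_at_top[of 1] by eventually_elim simp
  qed
  then have n_le: "\<forall>\<^sub>F m in at_top. n m \<le> m"
    by simp
  have k_upper: "\<forall>\<^sub>F m in at_top. real (k m) < real m / (ln (real m))\<^sup>2"
    using k_range by eventually_elim simp
  have "solves_planted_set_cover k n (\<lambda>m. decide_by alg \<epsilon> (c * real (k m) / \<epsilon>\<^sup>2) (k m) m)"
    unfolding solves_planted_set_cover_def
    using k_ev k_le_n n_le union_bound_eventually[OF \<open>0 < a\<close> \<open>0 < \<epsilon>\<close> k_upper n_le]
  proof eventually_elim
    case (elim m)
    let ?D = "decide_by alg \<epsilon> (c * real (k m) / \<epsilon>\<^sup>2) (k m) m"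
    let ?T = "nat \<lfloor>a * real (k m)\<rfloor>"
    \<comment> \<open>Every system in the support satisfies the promise;
      \<open>k m \<le> n m \<le> m\<close> guarantees that partitions into \<open>k m\<close> blocks
      exist. The test is therefore passed with probability 1.\<close>
    have "?D F" if "F \<in> set_pmf (yes_case m (k m) (n m))" for F
    proof -
      have "\<exists>x. exact_solution (incidence_mat m F) (ones_vec m) x \<and> sparse (real (k m)) x"
        using that elim by (intro yes_case_exact_solution) auto
      moreover have "nonneg_system (incidence_mat m F) (ones_vec m)"
        by (simp add: nonneg_system_def nonneg_mat_def nonneg_vec_def incidence_mat_def ones_vec_def)
      ultimately have "approx_solution \<epsilon> (incidence_mat m F) (ones_vec m) (alg (k m) \<epsilon> (incidence_mat m F) (ones_vec m))"
        "sparse (s (k m) \<epsilon>) (alg (k m) \<epsilon> (incidence_mat m F) (ones_vec m))"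
        using alg \<epsilon> unfolding finds_sparse_solutions_def by auto
      moreover have "s (k m) \<epsilon> \<le> c * real (k m) / \<epsilon>\<^sup>2"
        using s[OF elim(1) \<open>Q \<epsilon>\<close>] by simp
      ultimately show ?thesis
        unfolding decide_by_def Let_def sparse_def by linarith
    qed
    then have "measure_pmf.prob (yes_case m (k m) (n m)) {F. ?D F} = 1"
      by (subst measure_pmf.prob_eq_1) (auto intro: AE_pmfI)
    moreover have "measure_pmf.prob (no_case m (k m) (n m)) {F. ?D F} < 1 / 3"
    proof -
      \<comment> \<open>The number of nonzero entries is an integer, so the real threshold may be
        replaced by its floor, as the count of grid vectors requires.\<close>
      have sparse_T: "sparse (real ?T) x" if "sparse (c * real (k m) / \<epsilon>\<^sup>2) x" for x
        using that unfolding sparse_def t_eq of_nat_le_iff by (rule le_nat_floor)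
      have T: "real ?T \<le> a * real (k m)"
        using \<open>0 < a\<close> by simp
      with elim have T': "real ?T \<le> \<epsilon> * (real m)\<^sup>2"
        by linarith
      have "measure_pmf.prob (no_case m (k m) (n m)) {F. ?D F} \<le>
          measure_pmf.prob (no_case m (k m) (n m))
            {F. \<exists>x. approx_solution \<epsilon> (incidence_mat m F) (ones_vec m) x \<and> sparse (real ?T) x}"
        by (intro measure_pmf.finite_measure_mono) (auto simp: decide_by_def Let_def dest: sparse_T)
      also have "\<dots> \<le> real ((n m * (2 * m\<^sup>2 + 1)) ^ ?T) * exp (- 2 * \<epsilon> * real m)"
        using elim \<epsilon> T T' unfolding a_def by (intro prob_no_case_sparse_solution_le) auto
      also have "\<dots> < 1 / 3"
        using elim by blast
      finally show ?thesis .
    qed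
    moreover have "measure_pmf.prob (no_case m (k m) (n m)) {F. \<not> ?D F} =
        1 - measure_pmf.prob (no_case m (k m) (n m)) {F. ?D F}"
      using measure_pmf.prob_compl[of "{F. ?D F}" "no_case m (k m) (n m)"]
      by (simp add: Compl_eq_Diff_UNIV[symmetric] Collect_neg_eq)
    ultimately show ?case
      by linarith
  qed
  moreover have "\<epsilon> < 1" "0 < c"
    using \<epsilon> by (simp_all add: c_def)
  ultimately show ?thesis
    unfolding can_solve_planted_set_cover_def using \<open>0 < \<epsilon>\<close> by blast
qed

end
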